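(* Let $(r_n)_{n \in \mathbb{N}}$ be a sequence of positive real numbers, and suppose that there exists $C>1$ such that $r_{n+1} > C r_n$ for all $n \in \mathbb{N}$. Then there is a transcendental entire function $f$ in the Eremenko–Lyubich class $\mathcal{B}$, of finite order $\rho(f) < \infty$, such that the maximum modulus set $\mathcal{M}(f)$ has a discontinuity at $r_n$, for all $n \in \mathbb{N}$.
   Context: For an entire function $f$, the maximum modulus is $M(r,f) := \max_{|z|=r}|f(z)|$ for $r \ge 0$, and the maximum modulus set is $\mathcal{M}(f) := \{z \in \mathbb{C} : |f(z)| = M(|z|,f)\}$. For $r>0$, we say that $\mathcal{M}(f)$ has a discontinuity at $r$ if there exist a connected component $\Gamma$ of $\mathcal{M}(f)$ and a point $z \in \Gamma$ with $|z| = r$ such that $\Gamma$ contains no points of modulus less than $r$. The order of a transcendental entire function $f$ is $\rho(f) := \limsup_{r\to\infty} \frac{\log\log M(r,f)}{\log r}$. The Eremenko–Lyubich class $\mathcal{B}$ is the class of transcendental entire functions $f$ whose set of (finite) singular values is bounded, where singular values are those values through which some inverse branch of $f$ cannot be continued; equivalently, the set of finite critical values and finite asymptotic values of $f$ is bounded in $\mathbb{C}$. *)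

theory Defs
  imports
    "HOL-Complex_Analysis.Complex_Analysis"
    "HOL-Computational_Algebra.Polynomial"
begin

definition transcendental_entire :: "(complex \<Rightarrow> complex) \<Rightarrow> bool" where
  "transcendental_entire f \<longleftrightarrow>
     f holomorphic_on UNIV \<and> \<not> (\<exists>p :: complex poly. \<forall>z. f z = poly p z)"

text \<open>For entire functions and \<open>r \<ge> 0\<close> the supremum is attained;
  see \<open>max_modulus_attained\<close> below.\<close>

definition max_modulus :: "real \<Rightarrow> (complex \<Rightarrow> complex) \<Rightarrow> real" where
  "max_modulus r f = (SUP z\<in>sphere 0 r. cmod (f z))"

definition max_modulus_set :: "(complex \<Rightarrow> complex) \<Rightarrow> complex set" where
  "max_modulus_set f = {z. cmod (f z) = max_modulus (cmod z) f}"

definition has_discontinuity_at :: "(complex \<Rightarrow> complex) \<Rightarrow> real \<Rightarrow> bool" where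
  "has_discontinuity_at f r \<longleftrightarrow>
     0 < r \<and>
     (\<exists>\<Gamma> \<in> components (max_modulus_set f).
        (\<exists>z\<in>\<Gamma>. cmod z = r) \<and> \<not> (\<exists>w\<in>\<Gamma>. cmod w < r))"

text \<open>For a transcendental entire function the maximum modulus tends to infinity, so the
  values of \<open>ln\<close> outside its natural domain do not affect the limit superior.\<close>

definition growth_order :: "(complex \<Rightarrow> complex) \<Rightarrow> ereal" where
  "growth_order f = Limsup at_top (\<lambda>r::real. ereal (ln (ln (max_modulus r f)) / ln r))"

definition inverse_branch ::
    "(complex \<Rightarrow> complex) \<Rightarrow> complex set \<Rightarrow> (complex \<Rightarrow> complex) \<Rightarrow> bool" where
  "inverse_branch f U g \<longleftrightarrow>
     open U \<and> connected U \<and> U \<noteq> {} \<and> g holomorphic_on U \<and> (\<forall>w\<in>U. f (g w) = w)"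

text \<open>A finite value \<open>a\<close> is singular if no disc around \<open>a\<close> has the property that every inverse
  branch given on some domain inside the disc continues to the whole disc. These values form
  the closure of the set of finite critical and asymptotic values.\<close>

definition singular_values :: "(complex \<Rightarrow> complex) \<Rightarrow> complex set" where
  "singular_values f =
     {a. \<forall>\<delta>>0. \<exists>U g. U \<subseteq> ball a \<delta> \<and> inverse_branch f U g \<and>
           \<not> (\<exists>h. inverse_branch f (ball a \<delta>) h \<and> (\<forall>w\<in>U. h w = g w))}"

definition eremenko_lyubich_class :: "(complex \<Rightarrow> complex) set" where
  "eremenko_lyubich_class = {f. transcendental_entire f \<and> bounded (singular_values f)}"

lemma max_modulus_attained:
  assumes "f holomorphic_on UNIV" and "0 \<le> r"
  shows "\<exists>z\<in>sphere 0 r. cmod (f z) = max_modulus r f \<and> (\<forall>w\<in>sphere 0 r. cmod (f w) \<le> cmod (f z))"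
proof -
  have "continuous_on (sphere 0 r) (\<lambda>z. cmod (f z))"
    using holomorphic_on_imp_continuous_on[OF assms(1)]
    by (intro continuous_on_norm) (rule continuous_on_subset, auto)
  moreover have "sphere (0::complex) r \<noteq> {}"
    using assms(2) by simp
  ultimately obtain z where z: "z \<in> sphere 0 r" "\<forall>w\<in>sphere 0 r. cmod (f w) \<le> cmod (f z)"
    using continuous_attains_sup[OF compact_sphere] by metis
  then have "max_modulus r f = cmod (f z)"
    unfolding max_modulus_def by (intro cSup_eq_maximum) auto
  with z show ?thesis by auto
qed

end

theory Submission
  imports Defs
begin

text \<open>The function is \<open>f z = A * cosh z + H z + G z\<close> with
  \<open>H z = cosh (z/2) * (\<Prod>n. 1 + u n + u n * cosh (a n * z))\<close> and
  \<open>G z = sinh (z/2) * (\<Prod>n. 1 + u n - u n * cosh (a n * z))\<close>,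
where \<open>u n = 1 / (cosh (a n * r n) - 1)\<close> and the positive numbers \<open>a n\<close> satisfy
\<open>(\<Sum>n. a n) \<le> 1/2\<close>. The \<open>n\<close>-th factor of \<open>G\<close> vanishes on the real line exactly at
\<open>r n\<close> and \<open>- r n\<close>, and the products converge as soon as \<open>\<Sum>n. u n\<close> does. The growth
\<open>r (n + 1) > C * r n\<close> makes this possible: with \<open>a n\<close> a multiple of \<open>C powr (- n/2)\<close> the
products \<open>a n * r n\<close> still grow at least like \<open>C powr (n/2)\<close>.

Expanding the products, \<open>H + G\<close> is a limit of finite sums of exponentials \<open>exp (t * z)\<close>,
\<open>t\<close> real, with nonnegative coefficients: each coefficient of \<open>G\<close> is at most the corresponding
one of \<open>H\<close> in absolute value. So \<open>f\<close> is dominated on each vertical line by its value on the real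
axis, and \<open>f\<close> is strictly convex there. Hence the maximum modulus on the circle of radius \<open>s\<close> is
attained only at \<open>s\<close> or \<open>- s\<close>, and the sign of \<open>f s - f (- s) = 2 * G s\<close> decides at which of
the two (\<open>max_modulus_set_on_real_axis\<close>). At \<open>s = r n\<close> both points are maximal, but on
radii slightly smaller than \<open>r n\<close> they are not, so one of the components of the maximum
modulus set through \<open>r n\<close> and \<open>- r n\<close> cannot be continued inwards
(\<open>has_discontinuity_at_if_swap\<close>). 

Since all exponents satisfy \<open>\<bar>t\<bar> \<le> 1\<close>, the function \<open>H + G\<close> and, by Cauchy's estimate,
its derivative are bounded by a constant times \<open>exp \<bar>Re z\<bar>\<close>. So \<open>f\<close> has exponential type,
and for large \<open>A\<close> it inherits from \<open>A * cosh z\<close> that \<open>\<bar>f' z\<bar> \<ge> 1\<close> wherever \<open>\<bar>f z\<bar>\<close>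
is large. Inverse branches are then Lipschitz over the region of large values, so they cannot run off
to infinity and continue to discs of fixed size
(\<open>bounded_singular_values_if_deriv_bounded_below\<close>); this puts \<open>f\<close> into the
Eremenko--Lyubich class.\<close>

section \<open>Continuation of inverse branches\<close>

lemma inverse_branch_subset:
  assumes "inverse_branch f U g" "V \<subseteq> U" "open V" "connected V" "V \<noteq> {}"
  shows "inverse_branch f V g"
  using assms unfolding inverse_branch_def by (auto intro: holomorphic_on_subset)

lemma inverse_branch_deriv:
  assumes "f holomorphic_on UNIV" "inverse_branch f U g" "w \<in> U"
  shows "deriv f (g w) * deriv g w = 1"
proof -
  have U: "open U" "g holomorphic_on U" "\<And>w. w \<in> U \<Longrightarrow> f (g w) = w"
    using assms(2) by (auto simp: inverse_branch_def)
  have "(g has_field_derivative deriv g w) (at w)"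
    using U assms(3) holomorphic_derivI by blast
  moreover have "(f has_field_derivative deriv f (g w)) (at (g w))"
    using assms(1) holomorphic_derivI by blast
  ultimately have "((\<lambda>w. f (g w)) has_field_derivative deriv f (g w) * deriv g w) (at w)"
    using DERIV_chain2 by blast
  moreover have "((\<lambda>w. f (g w)) has_field_derivative 1) (at w)"
    by (rule has_field_derivative_transform_within_open[where f="\<lambda>w. w" and S=U])
       (use U assms(3) in auto)
  ultimately show ?thesis
    using DERIV_unique by blast
qed

text \<open>Near the common value \<open>g w0\<close> the function \<open>f\<close> is injective, which forces the two branches to agree
on a neighbourhood of \<open>w0\<close>; the identity theorem does the rest.\<close>

lemma inverse_branch_unique:
  assumes hol: "f holomorphic_on UNIV"
    and g: "inverse_branch f U g" and h: "inverse_branch f V h"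
    and W: "open W" "connected W" "W \<subseteq> U" "W \<subseteq> V"
    and w0: "w0 \<in> W" "g w0 = h w0" and w: "w \<in> W"
  shows "g w = h w"
proof -
  have hg: "g holomorphic_on W" "h holomorphic_on W"
    using g h W by (auto simp: inverse_branch_def intro: holomorphic_on_subset)
  have "deriv f (g w0) \<noteq> 0"
    using inverse_branch_deriv[OF hol g, of w0] w0 W by auto
  then obtain s where s: "s > 0" "inj_on f (ball (g w0) s)"
    using has_complex_derivative_locally_injective[OF hol, of "g w0"] by auto
  define N where "N = (W \<inter> g -` ball (g w0) s) \<inter> (W \<inter> h -` ball (g w0) s)"
  have "open N"
    unfolding N_def
    by (intro open_Int continuous_open_preimage holomorphic_on_imp_continuous_on hg W open_ball)
  moreover have "w0 \<in> N"
    using w0 s by (simp add: N_def)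
  moreover have "g v = h v" if "v \<in> N" for v
  proof -
    have "v \<in> W" "v \<in> U" "v \<in> V"
      using that W by (auto simp: N_def)
    then have "f (g v) = f (h v)"
      using g h by (simp add: inverse_branch_def)
    then show ?thesis
      using s(2) that by (auto simp: N_def inj_on_def)
  qed
  moreover have "N \<subseteq> W"
    by (auto simp: N_def)
  ultimately show ?thesis
    using analytic_continuation_open[of N W g h w, OF _ W(1) _ W(2) _ hg] w by blast
qed

text \<open>The radius \<open>\<eta>\<close> does not depend on \<open>z\<close>. This uniformity is what lets a branch be continued in
finitely many steps of equal length.\<close>

lemma uniform_local_inverse:
  assumes hol: "f holomorphic_on UNIV" and E: "compact E"
    and nz: "\<And>z. z \<in> E \<Longrightarrow> deriv f z \<noteq> 0"
  obtains \<eta> where "\<eta> > 0" "\<And>z. z \<in> E \<Longrightarrow> \<exists>k. inverse_branch f (ball (f z) \<eta>) k \<and> k (f z) = z"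
proof -
  have "\<exists>V \<epsilon>. open V \<and> p \<in> V \<and> \<epsilon> > 0 \<and>
          (\<forall>z\<in>V. \<exists>k. inverse_branch f (ball (f z) \<epsilon>) k \<and> k (f z) = z)" if p: "p \<in> E" for p
  proof -
    obtain s where s: "s > 0" "inj_on f (ball p s)"
      using has_complex_derivative_locally_injective[OF hol, of p] nz[OF p] by auto
    have hols: "f holomorphic_on ball p s"
      using hol holomorphic_on_subset by blast
    obtain k where k: "k holomorphic_on f ` ball p s" "\<And>z. z \<in> ball p s \<Longrightarrow> k (f z) = z"
      using holomorphic_has_inverse[OF hols open_ball s(2)] by metis
    have "open (f ` ball p s)"
      using open_mapping_thm3[OF hols open_ball s(2)] .
    then obtain \<epsilon> where \<epsilon>: "\<epsilon> > 0" "ball (f p) \<epsilon> \<subseteq> f ` ball p s"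
      using s(1) by (meson centre_in_ball image_eqI open_contains_ball_eq)
    define V where "V = ball p s \<inter> f -` ball (f p) (\<epsilon>/2)"
    have "open V"
      unfolding V_def
      by (intro continuous_open_preimage holomorphic_on_imp_continuous_on hols open_ball)
    moreover have "p \<in> V"
      using s \<epsilon> by (simp add: V_def)
    moreover have "inverse_branch f (ball (f z) (\<epsilon>/2)) k \<and> k (f z) = z" if "z \<in> V" for z
    proof -
      have sub: "ball (f z) (\<epsilon>/2) \<subseteq> f ` ball p s"
      proof -
        have "dist (f p) (f z) < \<epsilon>/2"
          using that by (simp add: V_def)
        then have "ball (f z) (\<epsilon>/2) \<subseteq> ball (f p) \<epsilon>"
          by (simp add: ball_subset_ball_iff dist_commute)
        then show ?thesis using \<epsilon> by blast
      qed
      then show ?thesis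
        using \<epsilon> k that by (auto simp: inverse_branch_def V_def intro: holomorphic_on_subset)
    qed
    ultimately show ?thesis
      using \<epsilon>(1) by (metis half_gt_zero)
  qed
  then obtain V \<epsilon> where V: "\<And>p. p \<in> E \<Longrightarrow> open (V p) \<and> p \<in> V p \<and> \<epsilon> p > (0::real) \<and>
          (\<forall>z\<in>V p. \<exists>k. inverse_branch f (ball (f z) (\<epsilon> p)) k \<and> k (f z) = z)"
    by metis
  obtain D where D: "D \<subseteq> E" "finite D" "E \<subseteq> (\<Union>p\<in>D. V p)"
    using compactE_image[OF E, of E V] V by blast
  define \<eta> where "\<eta> = Min (insert 1 (\<epsilon> ` D))"
  have "\<eta> > 0"
    unfolding \<eta>_def using D V by (subst Min_gr_iff) auto
  moreover have "\<exists>k. inverse_branch f (ball (f z) \<eta>) k \<and> k (f z) = z" if z: "z \<in> E" for z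
  proof -
    obtain p where p: "p \<in> D" "z \<in> V p"
      using D z by blast
    then obtain k where k: "inverse_branch f (ball (f z) (\<epsilon> p)) k" "k (f z) = z"
      using V D by blast
    have "\<eta> \<le> \<epsilon> p"
      unfolding \<eta>_def using D p by (intro Min_le) auto
    then show ?thesis
      using inverse_branch_subset[OF k(1) subset_ball, of \<eta>] k(2) \<open>\<eta> > 0\<close> by auto
  qed
  ultimately show ?thesis
    using that by blast
qed

text \<open>A point \<open>v\<close> of the larger ball is served by the local branch centred at its contraction \<open>p v\<close>
towards \<open>w0\<close>, which lies in the smaller ball and within \<open>\<eta>/2\<close> of \<open>v\<close>. The local branches at
\<open>p v\<close> and \<open>p v'\<close> for neighbouring \<open>v\<close> and \<open>v'\<close> both agree with \<open>h\<close> near \<open>p v\<close> and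
therefore with each other, so the pieces fit together to a holomorphic function.\<close>

lemma inverse_branch_enlarge_ball:
  assumes hol: "f holomorphic_on UNIV"
    and h: "inverse_branch f (ball w0 \<rho>) h" and "\<rho> > 0" "\<eta> > 0"
    and loc: "\<And>w. w \<in> ball w0 \<rho> \<Longrightarrow> \<exists>k. inverse_branch f (ball w \<eta>) k \<and> k w = h w"
  shows "\<exists>h'. inverse_branch f (ball w0 (\<rho> + \<eta>/2)) h' \<and> h' w0 = h w0"
proof -
  obtain K where K: "\<And>w. w \<in> ball w0 \<rho> \<Longrightarrow> inverse_branch f (ball w \<eta>) (K w) \<and> K w w = h w"
    using loc by metis
  define q where "q = \<rho> / (\<rho> + \<eta>/2)"
  have q: "0 < q" "q < 1" "q * (\<rho> + \<eta>/2) = \<rho>"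
    using assms by (auto simp: q_def field_simps add_pos_pos)
  define p where "p v = w0 + of_real q * (v - w0)" for v
  have p_in: "p v \<in> ball w0 \<rho>" if "v \<in> ball w0 (\<rho> + \<eta>/2)" for v
  proof -
    have "dist w0 (p v) = q * dist w0 v"
      using q by (simp add: p_def dist_norm norm_mult norm_minus_commute)
    also have "\<dots> < q * (\<rho> + \<eta>/2)"
      using that q by (intro mult_strict_left_mono) auto
    finally show ?thesis using q by simp
  qed
  have p_near: "dist (p v) v < \<eta>/2" if "v \<in> ball w0 (\<rho> + \<eta>/2)" for v
  proof -
    have "p v - v = of_real (q - 1) * (v - w0)"
      by (simp add: p_def algebra_simps)
    then have "dist (p v) v = (1 - q) * dist w0 v"
      using q by (simp add: dist_norm norm_mult norm_minus_commute del: of_real_diff)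
    also have "\<dots> < (1 - q) * (\<rho> + \<eta>/2)"
      using that q by (intro mult_strict_left_mono) auto
    also have "\<dots> = \<eta>/2"
      using q(3) by (simp add: left_diff_distrib)
    finally show ?thesis .
  qed
  have p_contr: "dist (p v) (p v') \<le> dist v v'" for v v'
  proof -
    have "p v - p v' = of_real q * (v - v')"
      by (simp add: p_def algebra_simps)
    then show ?thesis
      using q by (simp add: dist_norm norm_mult mult_left_le_one_le)
  qed
  define h' where "h' v = K (p v) v" for v
  have local: "h' v' = K (p v) v'"
    if v: "v \<in> ball w0 (\<rho> + \<eta>/2)" and v': "v' \<in> ball w0 (\<rho> + \<eta>/2)" "dist v v' < \<eta>/2" for v v'
  proof -
    have "dist (p v') (p v) < \<eta>"
      using p_contr[of v' v] v' assms(4) by (simp add: dist_commute)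
    then have "K (p v') (p v) = h (p v)"
      using inverse_branch_unique[OF hol _ h, of "ball (p v') \<eta>" "K (p v')"
          "ball (p v') \<eta> \<inter> ball w0 \<rho>" "p v'" "p v"] K[OF p_in[OF v'(1)]] p_in[OF v] p_in[OF v'(1)] assms(4)
      by (auto simp: convex_Int convex_connected)
    then have eq: "K (p v') (p v) = K (p v) (p v)"
      using K p_in v by simp
    have "dist (p v) v' < \<eta>"
      using p_near[OF v] v'(2) dist_triangle_lt[of "p v" v v' \<eta>] by (simp add: dist_commute)
    moreover have "dist (p v') v' < \<eta>"
      using p_near[OF v'(1)] assms(4) by simp
    ultimately show ?thesis
      unfolding h'_def
      using inverse_branch_unique[OF hol, of "ball (p v') \<eta>" "K (p v')" "ball (p v) \<eta>" "K (p v)"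
          "ball (p v') \<eta> \<inter> ball (p v) \<eta>" "p v" v'] K[OF p_in[OF v'(1)]] K[OF p_in[OF v]]
        \<open>dist (p v') (p v) < \<eta>\<close> eq assms(4)
      by (auto simp: convex_Int convex_connected)
  qed
  have "h' field_differentiable (at v)" if v: "v \<in> ball w0 (\<rho> + \<eta>/2)" for v
  proof -
    have "K (p v) holomorphic_on ball (p v) \<eta>" "v \<in> ball (p v) \<eta>"
      using K[OF p_in[OF v]] p_near[OF v] assms(4) by (auto simp: inverse_branch_def)
    then have "K (p v) field_differentiable (at v)"
      using holomorphic_on_imp_differentiable_at open_ball by blast
    then obtain D where "(K (p v) has_field_derivative D) (at v)"
      by (auto simp: field_differentiable_def)
    then have "(h' has_field_derivative D) (at v)"
    proof (rule has_field_derivative_transform_within_open)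
      show "open (ball w0 (\<rho> + \<eta>/2) \<inter> ball v (\<eta>/2))" by auto
      show "v \<in> ball w0 (\<rho> + \<eta>/2) \<inter> ball v (\<eta>/2)" using v assms(4) by auto
    qed (use local[OF v] in auto)
    then show ?thesis by (auto simp: field_differentiable_def)
  qed
  then have "h' holomorphic_on ball w0 (\<rho> + \<eta>/2)"
    by (auto simp: holomorphic_on_def intro: field_differentiable_at_within)
  moreover have "f (h' v) = v" if "v \<in> ball w0 (\<rho> + \<eta>/2)" for v
    using K[OF p_in[OF that]] p_near[OF that] assms(4) by (auto simp: h'_def inverse_branch_def)
  moreover have "h' w0 = h w0"
    using K[of w0] assms(3) by (simp add: h'_def p_def)
  ultimately show ?thesis
    using assms(3,4) by (intro exI[of _ h']) (auto simp: inverse_branch_def)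
qed

text \<open>A branch over a ball has derivative of modulus at most \<open>1/c\<close>, so its values stay in the fixed compact
set \<open>E\<close>. On \<open>E\<close> the local inverses have a common radius \<open>\<eta>\<close>, and the ball can be enlarged
by \<open>\<eta>/2\<close> until its radius is \<open>\<delta>\<close>.\<close>

lemma inverse_branch_on_ball:
  assumes hol: "f holomorphic_on UNIV" and "c > 0" "\<delta> > 0"
    and der: "\<And>z. f z \<in> cball (f z0) \<delta> \<Longrightarrow> c \<le> cmod (deriv f z)"
  shows "\<exists>h. inverse_branch f (ball (f z0) \<delta>) h \<and> h (f z0) = z0"
proof -
  define E where "E = cball z0 (\<delta>/c) \<inter> f -` cball (f z0) \<delta>"
  have "closed (UNIV \<inter> f -` cball (f z0) \<delta>)"
    by (intro continuous_closed_preimage holomorphic_on_imp_continuous_on[OF hol]) auto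
  then have "compact E"
    by (auto simp: E_def intro: compact_Int_closed)
  moreover have "deriv f z \<noteq> 0" if "z \<in> E" for z
    using der[of z] \<open>c > 0\<close> that by (auto simp: E_def)
  ultimately obtain \<eta> where \<eta>: "\<eta> > 0"
    "\<And>z. z \<in> E \<Longrightarrow> \<exists>k. inverse_branch f (ball (f z) \<eta>) k \<and> k (f z) = z"
    using uniform_local_inverse[OF hol] by metis
  have z0E: "z0 \<in> E"
    using assms(2,3) by (simp add: E_def)
  have step: "\<exists>h. inverse_branch f (ball (f z0) (min \<delta> (real (Suc n) * (\<eta>/2)))) h \<and> h (f z0) = z0"
    for n
  proof (induction n)
    case 0
    obtain k where k: "inverse_branch f (ball (f z0) \<eta>) k" "k (f z0) = z0"
      using \<eta>(2)[OF z0E] by blast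
    then have "inverse_branch f (ball (f z0) (min \<delta> (real (Suc 0) * (\<eta>/2)))) k"
      using \<eta>(1) assms(3) by (intro inverse_branch_subset[OF k(1)]) auto
    then show ?case using k by blast
  next
    case (Suc n)
    define \<rho> where "\<rho> = min \<delta> (real (Suc n) * (\<eta>/2))"
    have \<rho>: "0 < \<rho>" "\<rho> \<le> \<delta>"
      using \<eta>(1) assms(3) by (auto simp: \<rho>_def)
    obtain h where h: "inverse_branch f (ball (f z0) \<rho>) h" "h (f z0) = z0"
      using Suc unfolding \<rho>_def by blast
    then have hh: "h holomorphic_on ball (f z0) \<rho>" "\<And>w. w \<in> ball (f z0) \<rho> \<Longrightarrow> f (h w) = w"
      by (auto simp: inverse_branch_def)
    have dh: "(h has_field_derivative deriv h w) (at w within ball (f z0) \<rho>)" "cmod (deriv h w) \<le> 1/c"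
      if w: "w \<in> ball (f z0) \<rho>" for w
    proof -
      show "(h has_field_derivative deriv h w) (at w within ball (f z0) \<rho>)"
        using holomorphic_derivI[OF hh(1) open_ball w] by (rule has_field_derivative_at_within)
      have "c \<le> cmod (deriv f (h w))"
        using hh(2)[OF w] w \<rho> by (intro der) auto
      moreover have "cmod (deriv f (h w)) * cmod (deriv h w) = 1"
        using inverse_branch_deriv[OF hol h(1) w] by (metis norm_mult norm_one)
      ultimately have "c * cmod (deriv h w) \<le> 1"
        by (metis mult_right_mono norm_ge_zero)
      then show "cmod (deriv h w) \<le> 1/c"
        using \<open>c > 0\<close> by (simp add: field_simps)
    qed
    have hE: "h w \<in> E" if w: "w \<in> ball (f z0) \<rho>" for w
    proof -
      have "cmod (h w - h (f z0)) \<le> 1/c * cmod (w - f z0)"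
        by (rule field_differentiable_bound[OF convex_ball dh]) (use w \<rho> in auto)
      also have "\<dots> \<le> 1/c * \<delta>"
        using w \<rho> \<open>c > 0\<close> by (intro mult_left_mono) (auto simp: dist_norm norm_minus_commute)
      finally show ?thesis
        using h(2) hh(2)[OF w] w \<rho> by (auto simp: E_def dist_norm norm_minus_commute)
    qed
    have "\<exists>k. inverse_branch f (ball w \<eta>) k \<and> k w = h w" if w: "w \<in> ball (f z0) \<rho>" for w
      using \<eta>(2)[OF hE[OF w]] by (simp only: hh(2)[OF w])
    then obtain h' where h': "inverse_branch f (ball (f z0) (\<rho> + \<eta>/2)) h'" "h' (f z0) = z0"
      using inverse_branch_enlarge_ball[OF hol h(1) \<rho>(1) \<eta>(1)] unfolding h(2) by blast
    define \<rho>' where "\<rho>' = min \<delta> (real (Suc (Suc n)) * (\<eta>/2))"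
    have "real (Suc (Suc n)) * (\<eta>/2) = real (Suc n) * (\<eta>/2) + \<eta>/2"
      by (simp add: field_simps)
    then have "\<rho>' \<le> \<rho> + \<eta>/2"
      using \<eta>(1) unfolding \<rho>_def \<rho>'_def by linarith
    moreover have "0 < \<rho>'"
      using \<eta>(1) assms(3) by (simp add: \<rho>'_def)
    ultimately have "inverse_branch f (ball (f z0) \<rho>') h'"
      by (intro inverse_branch_subset[OF h'(1)] subset_ball) auto
    then show ?case
      unfolding \<rho>'_def[symmetric] using h'(2) by (intro exI[of _ h'] conjI)
  qed
  obtain n where "\<delta> < real n * (\<eta>/2)"
    using reals_Archimedean3[of "\<eta>/2"] \<eta>(1) by (meson half_gt_zero)
  moreover have "real n * (\<eta>/2) \<le> real (Suc n) * (\<eta>/2)"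
    using \<eta>(1) by (intro mult_right_mono) auto
  ultimately have "\<delta> \<le> real (Suc n) * (\<eta>/2)"
    by linarith
  then have "min \<delta> (real (Suc n) * (\<eta>/2)) = \<delta>"
    by (rule min_absorb1)
  then show ?thesis
    using step[of n] by (simp only:)
qed

text \<open>For \<open>\<bar>a\<bar> > R + 3\<close> the disc of radius 1 about \<open>a\<close> lies in the disc of radius 2 about any of
its points, and there all values of modulus at most \<open>R\<close> are still avoided.\<close>

lemma bounded_singular_values_if_deriv_bounded_below:
  assumes hol: "f holomorphic_on UNIV" and "c > 0"
    and der: "\<And>z. R < cmod (f z) \<Longrightarrow> c \<le> cmod (deriv f z)"
  shows "bounded (singular_values f)"
proof -
  have "cmod a \<le> R + 3" if a: "a \<in> singular_values f" for a
  proof (rule ccontr)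
    assume "\<not> cmod a \<le> R + 3"
    then have big: "cmod a > R + 3" by simp
    obtain U g where U: "U \<subseteq> ball a 1" "inverse_branch f U g"
      and noext: "\<not> (\<exists>h. inverse_branch f (ball a 1) h \<and> (\<forall>w\<in>U. h w = g w))"
      using a unfolding singular_values_def by (auto dest: spec[of _ 1])
    obtain w0 where w0: "w0 \<in> U"
      using U by (auto simp: inverse_branch_def)
    have fg: "f (g w0) = w0"
      using U w0 by (auto simp: inverse_branch_def)
    have "dist a w0 < 1"
      using U w0 by auto
    have "c \<le> cmod (deriv f z)" if "f z \<in> cball (f (g w0)) 2" for z
    proof -
      have "dist a (f z) < 3"
        using that \<open>dist a w0 < 1\<close> dist_triangle[of a "f z" w0] by (simp add: fg)
      then have "R < cmod (f z)"
        using big norm_triangle_ineq2[of a "f z"] by (simp add: dist_norm)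
      then show ?thesis by (rule der)
    qed
    then obtain h where h: "inverse_branch f (ball w0 2) h" "h w0 = g w0"
      using inverse_branch_on_ball[OF hol \<open>c > 0\<close>, of 2 "g w0"] fg by auto
    have sub: "ball a 1 \<subseteq> ball w0 2"
      using \<open>dist a w0 < 1\<close> by (simp add: ball_subset_ball_iff)
    have "inverse_branch f (ball a 1) h"
      by (rule inverse_branch_subset[OF h(1) sub]) auto
    moreover have "h w = g w" if "w \<in> U" for w
      by (rule inverse_branch_unique[OF hol h(1) U(2), of U w0])
         (use U sub w0 h that in \<open>auto simp: inverse_branch_def\<close>)
    ultimately show False using noext by blast
  qed
  then show ?thesis
    by (auto simp: bounded_iff)
qed

section \<open>Maximum modulus sets contained in the real axis\<close>

lemma max_modulus_on_real_axis:
  assumes dom: "\<And>z. cmod (f z) \<le> \<phi> (Re z)"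
    and real: "\<And>x. f (of_real x) = of_real (\<phi> x)"
    and strict: "\<And>x s. \<bar>x\<bar> < s \<Longrightarrow> \<phi> x < max (\<phi> s) (\<phi> (- s))"
    and "0 \<le> s"
  shows "max_modulus s f = max (\<phi> s) (\<phi> (- s))"
proof -
  have nonneg: "0 \<le> \<phi> x" for x
    using order_trans[OF norm_ge_zero dom[of "of_real x"]] by simp
  have "\<exists>x\<in>{s, -s}. max (\<phi> s) (\<phi> (- s)) = \<phi> x"
    by (simp add: max_def)
  then obtain x where x: "x \<in> {s, -s}" "max (\<phi> s) (\<phi> (- s)) = \<phi> x"
    by blast
  have "cmod (f w) \<le> max (\<phi> s) (\<phi> (- s))" if "w \<in> sphere 0 s" for w
  proof (cases "\<bar>Re w\<bar> < s")
    case True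
    then show ?thesis
      using dom[of w] strict[of "Re w" s] by linarith
  next
    case False
    then have "Re w = s \<or> Re w = - s"
      using that abs_Re_le_cmod[of w] by auto
    then show ?thesis
      using dom[of w] by auto
  qed
  moreover have "cmod (f (of_real x)) = max (\<phi> s) (\<phi> (- s))" "of_real x \<in> sphere (0::complex) s"
    using x nonneg \<open>0 \<le> s\<close> by (auto simp: real)
  ultimately show ?thesis
    unfolding max_modulus_def by (intro cSup_eq_maximum) (auto intro!: image_eqI[of _ _ "of_real x"])
qed

lemma max_modulus_set_on_real_axis:
  assumes dom: "\<And>z. cmod (f z) \<le> \<phi> (Re z)"
    and real: "\<And>x. f (of_real x) = of_real (\<phi> x)"
    and strict: "\<And>x s. \<bar>x\<bar> < s \<Longrightarrow> \<phi> x < max (\<phi> s) (\<phi> (- s))"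
  shows "max_modulus_set f = of_real ` {x. \<phi> (- x) \<le> \<phi> x}"
proof (rule set_eqI)
  fix z :: complex
  have nonneg: "0 \<le> \<phi> x" for x
    using order_trans[OF norm_ge_zero dom[of "of_real x"]] by simp
  have M: "max_modulus (cmod z) f = max (\<phi> (cmod z)) (\<phi> (- cmod z))"
    by (rule max_modulus_on_real_axis[OF dom real strict]) auto
  show "z \<in> max_modulus_set f \<longleftrightarrow> z \<in> of_real ` {x. \<phi> (- x) \<le> \<phi> x}"
  proof (cases "z \<in> \<real>")
    case False
    then have "Im z \<noteq> 0"
      by (simp add: complex_is_Real_iff)
    then have "\<bar>Re z\<bar> < cmod z"
      using abs_Re_le_cmod[of z] norm_complex_def[of z]
      by (metis abs_Re_le_cmod add_cancel_left_right cmod_power2 less_eq_real_def power2_abs power2_eq_iff_nonneg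
          abs_ge_zero norm_ge_zero zero_eq_power2)
    then have "cmod (f z) < max_modulus (cmod z) f"
      using dom[of z] strict[of "Re z" "cmod z"] M by simp
    then show ?thesis
      using False by (auto simp: max_modulus_set_def)
  next
    case True
    then obtain x where x: "z = of_real x"
      by (auto elim: Reals_cases)
    have "max (\<phi> \<bar>x\<bar>) (\<phi> (- \<bar>x\<bar>)) = max (\<phi> x) (\<phi> (- x))"
      by (auto simp: abs_if max.commute)
    then show ?thesis
      using M nonneg[of x] by (auto simp: x max_modulus_set_def real max_def)
  qed
qed

text \<open>If the components through \<open>s\<close> and through \<open>- s\<close> both contained points of modulus less than \<open>s\<close>,
then, being connected subsets of the real axis, they would contain \<open>x\<close> and \<open>- x\<close> for every \<open>x\<close>
slightly below \<open>s\<close>. Both points would then be maximal, contrary to \<open>\<phi> x \<noteq> \<phi> (- x)\<close> for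
suitable \<open>x\<close>.\<close>

lemma has_discontinuity_at_if_swap:
  assumes dom: "\<And>z. cmod (f z) \<le> \<phi> (Re z)"
    and real: "\<And>x. f (of_real x) = of_real (\<phi> x)"
    and strict: "\<And>x s. \<bar>x\<bar> < s \<Longrightarrow> \<phi> x < max (\<phi> s) (\<phi> (- s))"
    and "0 < s" and bal: "\<phi> s = \<phi> (- s)"
    and unbal: "\<And>t. t < s \<Longrightarrow> \<exists>x. t < x \<and> x < s \<and> \<phi> x \<noteq> \<phi> (- x)"
  shows "has_discontinuity_at f s"
proof (rule ccontr)
  assume no: "\<not> has_discontinuity_at f s"
  define M where "M = max_modulus_set f"
  have M: "M = of_real ` {x. \<phi> (- x) \<le> \<phi> x}"
    unfolding M_def by (rule max_modulus_set_on_real_axis[OF dom real strict])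
  \<comment> \<open>The factor \<open>\<sigma>\<close> treats the components through \<open>s\<close> and through \<open>- s\<close> together.\<close>
  have reach: "\<exists>t<s. \<forall>x. t < x \<and> x < s \<longrightarrow> \<phi> (- (\<sigma> * x)) \<le> \<phi> (\<sigma> * x)"
    if \<sigma>: "\<sigma> = 1 \<or> \<sigma> = - 1" for \<sigma> :: real
  proof -
    define p where "p = complex_of_real (\<sigma> * s)"
    define \<Gamma> where "\<Gamma> = connected_component_set M p"
    have "p \<in> M"
      using \<sigma> bal by (auto simp: M p_def)
    then have "\<Gamma> \<in> components M" "p \<in> \<Gamma>"
      by (auto simp: \<Gamma>_def components_def connected_component_refl)
    moreover have "cmod p = s"
      using \<sigma> \<open>0 < s\<close> by (auto simp: p_def)
    ultimately obtain w where w: "w \<in> \<Gamma>" "cmod w < s"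
      using no \<open>0 < s\<close> unfolding has_discontinuity_at_def M_def by blast
    have conn: "connected ((\<lambda>z. \<sigma> * Re z) ` \<Gamma>)"
      unfolding \<Gamma>_def
      by (intro connected_continuous_image connected_connected_component continuous_intros)
    have "\<phi> (- (\<sigma> * x)) \<le> \<phi> (\<sigma> * x)" if x: "cmod w < x" "x < s" for x
    proof -
      have "\<bar>\<sigma> * Re w\<bar> \<le> cmod w"
        using \<sigma> abs_Re_le_cmod[of w] by auto
      then have "\<sigma> * Re w \<le> x"
        using x by linarith
      moreover have "\<sigma> * Re p = s"
        using \<sigma> by (auto simp: p_def)
      ultimately have "x \<in> (\<lambda>z. \<sigma> * Re z) ` \<Gamma>"
        using connectedD_interval[OF conn, of "\<sigma> * Re w" "\<sigma> * Re p" x] w \<open>p \<in> \<Gamma>\<close> x by auto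
      then obtain v where v: "v \<in> \<Gamma>" "x = \<sigma> * Re v"
        by blast
      have "v \<in> M"
        using v(1) connected_component_subset unfolding \<Gamma>_def by blast
      moreover have "Re v = \<sigma> * x"
        using \<sigma> v(2) by auto
      ultimately show ?thesis
        by (auto simp: M)
    qed
    then show ?thesis
      using w(2) by blast
  qed
  obtain t1 where t1: "t1 < s" "\<And>x. t1 < x \<Longrightarrow> x < s \<Longrightarrow> \<phi> (- x) \<le> \<phi> x"
    using reach[of 1] by auto
  obtain t2 where t2: "t2 < s" "\<And>x. t2 < x \<Longrightarrow> x < s \<Longrightarrow> \<phi> x \<le> \<phi> (- x)"
    using reach[of "-1"] by auto
  obtain x where "max t1 t2 < x" "x < s" "\<phi> x \<noteq> \<phi> (- x)"
    using unbal[of "max t1 t2"] t1(1) t2(1) by auto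
  then show False
    using t1(2)[of x] t2(2)[of x] by auto
qed

section \<open>Exponential sums with nonnegative coefficients\<close>

text \<open>These are the Laplace transforms of positive measures with finite support on the real line. The cone
is closed under products, while the properties needed of its members, domination by the values
on the real axis and convexity there, pass to pointwise limits.\<close>

inductive pos_exp_sum :: "(complex \<Rightarrow> complex) \<Rightarrow> bool" where
  pos_exp_sum_exp: "0 \<le> c \<Longrightarrow> pos_exp_sum (\<lambda>z. of_real c * exp (of_real t * z))"
| pos_exp_sum_add: "pos_exp_sum F \<Longrightarrow> pos_exp_sum G \<Longrightarrow> pos_exp_sum (\<lambda>z. F z + G z)"

lemma pos_exp_sum_mult:
  assumes "pos_exp_sum F" "pos_exp_sum G"
  shows "pos_exp_sum (\<lambda>z. F z * G z)"
  using assms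
proof (induction F rule: pos_exp_sum.induct)
  case (pos_exp_sum_exp c t)
  show ?case
    using pos_exp_sum_exp(2)
  proof (induction G rule: pos_exp_sum.induct)
    case (pos_exp_sum_exp d s)
    have "pos_exp_sum (\<lambda>z. of_real (c * d) * exp (of_real (t + s) * z))"
      using pos_exp_sum_exp \<open>0 \<le> c\<close> by (intro pos_exp_sum.intros) auto
    then show ?case
      by (simp add: exp_add ring_distribs mult_ac)
  next
    case (pos_exp_sum_add F G)
    then show ?case
      using pos_exp_sum.pos_exp_sum_add by (simp add: ring_distribs)
  qed
next
  case (pos_exp_sum_add F1 F2)
  then show ?case
    using pos_exp_sum.pos_exp_sum_add by (simp add: ring_distribs)
qed

lemma pos_exp_sum_const: "0 \<le> c \<Longrightarrow> pos_exp_sum (\<lambda>z. of_real c)"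
  using pos_exp_sum_exp[of c 0] by simp

lemma pos_exp_sum_cosh: "0 \<le> c \<Longrightarrow> pos_exp_sum (\<lambda>z. of_real c * cosh (of_real t * z))"
  using pos_exp_sum_add[OF pos_exp_sum_exp[of "c/2" t] pos_exp_sum_exp[of "c/2" "-t"]]
  by (simp add: cosh_field_def field_simps)

lemma pos_exp_sum_ridge:
  assumes "pos_exp_sum F"
  shows "cmod (F z) \<le> Re (F (of_real (Re z)))"
  using assms
proof (induction F rule: pos_exp_sum.induct)
  case (pos_exp_sum_exp c t)
  have "exp (complex_of_real t * of_real (Re z)) = of_real (exp (t * Re z))"
    by (simp flip: of_real_mult exp_of_real)
  then show ?case
    using pos_exp_sum_exp by (simp add: norm_mult)
next
  case (pos_exp_sum_add F G)
  then show ?case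
    using norm_triangle_ineq[of "F z" "G z"] by simp
qed

lemma pos_exp_sum_convex:
  assumes "pos_exp_sum F"
  shows "convex_on UNIV (\<lambda>x. Re (F (of_real x)))"
  using assms
proof (induction F rule: pos_exp_sum.induct)
  case (pos_exp_sum_exp c t)
  have "convex_on UNIV (\<lambda>x. c * exp (t * x))"
  proof (rule convex_on_cmul[OF pos_exp_sum_exp])
    show "convex_on UNIV (\<lambda>x. exp (t * x))"
      by (rule f''_ge0_imp_convex[where f' = "\<lambda>x. t * exp (t * x)" and f'' = "\<lambda>x. t * t * exp (t * x)"])
         (auto intro!: derivative_eq_intros)
  qed
  moreover have "(\<lambda>x. Re (of_real c * exp (of_real t * complex_of_real x))) = (\<lambda>x. c * exp (t * x))"
    by (simp add: Re_exp)
  ultimately show ?case by simp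
next
  case (pos_exp_sum_add F G)
  then show ?case
    by (simp add: convex_on_add)
qed

lemma pos_exp_sum_limit_ridge:
  assumes F: "\<And>N. pos_exp_sum (F N)" and lim: "\<And>z. (\<lambda>N. F N z) \<longlonglongrightarrow> B z"
  shows "cmod (B z) \<le> Re (B (of_real (Re z)))"
    and "convex_on UNIV (\<lambda>x. Re (B (of_real x)))"
proof -
  show "cmod (B z) \<le> Re (B (of_real (Re z)))"
    by (rule LIMSEQ_le[OF tendsto_norm[OF lim] tendsto_Re[OF lim]])
       (use pos_exp_sum_ridge[OF F] in auto)
  show "convex_on UNIV (\<lambda>x. Re (B (of_real x)))"
  proof (rule convex_onI)
    fix t x y :: real assume t: "0 < t" "t < 1"
    have "\<forall>N. Re (F N (of_real ((1 - t) *\<^sub>R x + t *\<^sub>R y)))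
            \<le> (1 - t) * Re (F N (of_real x)) + t * Re (F N (of_real y))"
      using convex_onD[OF pos_exp_sum_convex[OF F], of t x y] t by simp
    then show "Re (B (of_real ((1 - t) *\<^sub>R x + t *\<^sub>R y)))
            \<le> (1 - t) * Re (B (of_real x)) + t * Re (B (of_real y))"
      by (intro LIMSEQ_le[OF tendsto_Re[OF lim]
            tendsto_add[OF tendsto_mult_left[OF tendsto_Re[OF lim]] tendsto_mult_left[OF tendsto_Re[OF lim]]]])
         auto
  qed auto
qed

text \<open>For exponential sums with real coefficients this says that every coefficient of \<open>G\<close> is bounded in
absolute value by the corresponding coefficient of \<open>H\<close>. Phrased by membership of \<open>H + G\<close> and
\<open>H - G\<close> in the cone, it avoids any reference to coefficients.\<close>

definition exp_majorises :: "(complex \<Rightarrow> complex) \<Rightarrow> (complex \<Rightarrow> complex) \<Rightarrow> bool" where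
  "exp_majorises H G \<longleftrightarrow> pos_exp_sum (\<lambda>z. H z + G z) \<and> pos_exp_sum (\<lambda>z. H z - G z)"

text \<open>Both \<open>H1 * H2 + G1 * G2\<close> and \<open>H1 * H2 - G1 * G2\<close> are half the sum of two products of the
functions \<open>H1 + G1\<close>, \<open>H1 - G1\<close>, \<open>H2 + G2\<close>, \<open>H2 - G2\<close>.\<close>

lemma exp_majorises_mult:
  assumes "exp_majorises H1 G1" "exp_majorises H2 G2"
  shows "exp_majorises (\<lambda>z. H1 z * H2 z) (\<lambda>z. G1 z * G2 z)"
proof -
  have *: "pos_exp_sum (\<lambda>z. of_real (1/2) * (F1 z * F2 z + F3 z * F4 z))"
    if "pos_exp_sum F1" "pos_exp_sum F2" "pos_exp_sum F3" "pos_exp_sum F4" for F1 F2 F3 F4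
    using that by (intro pos_exp_sum_mult pos_exp_sum_add pos_exp_sum_const) auto
  have 1: "H1 z * H2 z + G1 z * G2 z = of_real (1/2) *
     ((H1 z + G1 z) * (H2 z + G2 z) + (H1 z - G1 z) * (H2 z - G2 z))" for z
    by (simp add: field_simps)
  have 2: "H1 z * H2 z - G1 z * G2 z = of_real (1/2) *
     ((H1 z + G1 z) * (H2 z - G2 z) + (H1 z - G1 z) * (H2 z + G2 z))" for z
    by (simp add: field_simps)
  show ?thesis
    using assms unfolding exp_majorises_def 1 2 by (intro conjI *) auto
qed

lemma exp_majorises_cosh_sinh:
  "exp_majorises (\<lambda>z. cosh (of_real t * z)) (\<lambda>z. sinh (of_real t * z))"
  using pos_exp_sum_exp[of 1 t] pos_exp_sum_exp[of 1 "-t"]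
  by (simp add: exp_majorises_def cosh_plus_sinh cosh_minus_sinh)

lemma exp_majorises_factor:
  assumes "0 \<le> u"
  shows "exp_majorises (\<lambda>z. 1 + of_real u + of_real u * cosh (of_real a * z))
                       (\<lambda>z. 1 + of_real u - of_real u * cosh (of_real a * z))"
  using pos_exp_sum_const[of "2 + 2 * u"] pos_exp_sum_cosh[of "2 * u" a] assms
  by (simp add: exp_majorises_def algebra_simps)

lemma exp_majorises_prod:
  fixes N :: nat
  assumes "exp_majorises H G" "\<And>n. exp_majorises (h n) (g n)"
  shows "exp_majorises (\<lambda>z. H z * (\<Prod>n<N. h n z)) (\<lambda>z. G z * (\<Prod>n<N. g n z))"
proof (induction N)
  case (Suc N)
  show ?case
    using exp_majorises_mult[OF Suc assms(2)[of N]] by (simp add: mult.assoc)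
qed (use assms(1) in simp)

section \<open>Infinite products\<close>

lemma entire_product:
  fixes g :: "nat \<Rightarrow> complex \<Rightarrow> complex"
  assumes hol: "\<And>n. g n holomorphic_on UNIV"
    and bd: "\<And>n R z. cmod z \<le> R \<Longrightarrow> cmod (g n z - 1) \<le> u n * K R"
    and u: "summable u"
  obtains Q where "Q holomorphic_on UNIV" "\<And>z. (\<lambda>N. \<Prod>n<N. g n z) \<longlonglongrightarrow> Q z"
    "\<And>z. Q z = 0 \<longleftrightarrow> (\<exists>n. g n z = 0)"
proof -
  have unif: "uniformly_convergent_on (cball 0 R) (\<lambda>N z. \<Prod>n<N. g n z)" for R
  proof (rule uniformly_convergent_on_prod')
    show "continuous_on (cball 0 R) (g n)" for n
      using hol holomorphic_on_imp_continuous_on continuous_on_subset by blast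
    show "uniformly_convergent_on (cball 0 R) (\<lambda>N x. \<Sum>n<N. norm (g n x - 1))"
      by (rule Weierstrass_m_test'[where M = "\<lambda>n. u n * K R"])
         (use bd summable_mult2[OF u] in auto)
  qed auto
  define Q where "Q z = lim (\<lambda>N. \<Prod>n<N. g n z)" for z
  have lim: "uniform_limit (cball 0 R) (\<lambda>N z. \<Prod>n<N. g n z) Q sequentially" for R
    using unif[of R] unfolding Q_def uniformly_convergent_uniform_limit_iff .
  have ptw: "(\<lambda>N. \<Prod>n<N. g n z) \<longlonglongrightarrow> Q z" for z
    using tendsto_uniform_limitI[OF lim[of "cmod z"], of z] by simp
  have "Q holomorphic_on UNIV"
  proof (rule holomorphic_uniform_sequence[where f = "\<lambda>N z. \<Prod>n<N. g n z"])
    show "\<exists>d>0. cball x d \<subseteq> UNIV \<and> uniform_limit (cball x d) (\<lambda>N z. \<Prod>n<N. g n z) Q sequentially"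
      for x :: complex
    proof -
      have "cball x 1 \<subseteq> cball 0 (cmod x + 1)"
        by (simp add: cball_subset_cball_iff)
      then show ?thesis
        using uniform_limit_on_subset[OF lim] by (intro exI[of _ 1]) auto
    qed
  qed (use hol in \<open>auto intro!: holomorphic_intros\<close>)
  moreover have "Q z = 0 \<longleftrightarrow> (\<exists>n. g n z = 0)" for z
  proof
    assume "\<exists>n. g n z = 0"
    then obtain n where n: "g n z = 0" by blast
    have "\<forall>\<^sub>F N in sequentially. (\<Prod>n<N. g n z) = 0"
      using eventually_gt_at_top[of n] by eventually_elim (use n in auto)
    then have "(\<lambda>N. \<Prod>n<N. g n z) \<longlonglongrightarrow> 0"
      by (rule tendsto_eventually)
    then show "Q z = 0"
      using ptw LIMSEQ_unique by blast
  next
    assume 0: "Q z = 0"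
    show "\<exists>n. g n z = 0"
    proof (rule ccontr)
      assume no: "\<not> (\<exists>n. g n z = 0)"
      have "summable (\<lambda>n. norm (g n z - 1))"
        by (rule summable_comparison_test'[OF summable_mult2[OF u]]) (use bd[OF order_refl] in auto)
      then have "convergent_prod (\<lambda>n. 1 + (g n z - 1))"
        using no by (intro summable_imp_convergent_prod_complex) auto
      then have conv: "convergent_prod (\<lambda>n. g n z)" by simp
      then have "(\<lambda>N. \<Prod>n<N. g n z) \<longlonglongrightarrow> prodinf (\<lambda>n. g n z)"
        using convergent_prod_LIMSEQ[OF conv] by (simp add: LIMSEQ_lessThan_iff_atMost)
      then show False
        using prodinf_nonzero[OF conv] no 0 ptw[of z] LIMSEQ_unique by metis
    qed
  qed
  ultimately show ?thesis
    using that ptw by blast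
qed

section \<open>Estimates for hyperbolic functions\<close>

lemma norm_cosh_le: "cmod (cosh z) \<le> exp \<bar>Re z\<bar>"
  and norm_sinh_le: "cmod (sinh z) \<le> exp \<bar>Re z\<bar>"
proof -
  have "cmod (exp z) + cmod (exp (-z)) \<le> 2 * exp \<bar>Re z\<bar>"
    by (cases "Re z \<ge> 0") (auto simp: norm_exp_eq_Re)
  then show "cmod (cosh z) \<le> exp \<bar>Re z\<bar>" "cmod (sinh z) \<le> exp \<bar>Re z\<bar>"
    using norm_triangle_ineq[of "exp z" "exp (-z)"] norm_triangle_ineq4[of "exp z" "exp (-z)"]
    by (auto simp: cosh_field_def sinh_field_def norm_divide)
qed

lemma norm_sinh_ge: "cmod (sinh z) \<ge> (exp \<bar>Re z\<bar> - 1) / 2"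
proof -
  have "\<bar>cmod (exp z) - cmod (exp (-z))\<bar> \<ge> exp \<bar>Re z\<bar> - 1"
    by (cases "Re z \<ge> 0") (auto simp: norm_exp_eq_Re)
  then show ?thesis
    using norm_triangle_ineq3[of "exp z" "exp (-z)"]
    by (auto simp: sinh_field_def norm_divide)
qed

lemma complex_cosh_of_real: "cosh (complex_of_real x) = of_real (cosh x)"
  and complex_sinh_of_real: "sinh (complex_of_real x) = of_real (sinh x)"
  by (simp_all add: cosh_field_def sinh_field_def exp_minus exp_of_real)

text \<open>With \<open>e = exp (x/2)\<close> the right-hand side is \<open>(e - 1/e)^2 / 2\<close>, and \<open>e - 1/e \<ge> x/2\<close>. Only
the quadratic growth matters below, so the constant is not optimised.\<close>

lemma cosh_real_ge_quadratic:
  fixes x :: real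
  assumes "0 \<le> x"
  shows "x ^ 2 / 8 \<le> cosh x - 1"
proof -
  define e where "e = exp (x / 2)"
  have "exp x = e * e"
    by (simp add: e_def flip: exp_add)
  then have "cosh x - 1 = (e - 1 / e) ^ 2 / 2"
    by (simp add: cosh_field_def exp_minus e_def power2_eq_square field_simps)
  moreover have "1 / e \<le> 1" "1 + x / 2 \<le> e"
    using assms exp_ge_add_one_self[of "x / 2"] by (auto simp: e_def)
  then have "x / 2 \<le> e - 1 / e"
    by linarith
  then have "(x / 2) ^ 2 \<le> (e - 1 / e) ^ 2"
    using assms by (intro power_mono) auto
  ultimately show ?thesis
    by (simp add: power_divide)
qed

lemma norm_cosh_le_cosh_Re: "cmod (cosh z) \<le> cosh (Re z)"
  using pos_exp_sum_ridge[OF pos_exp_sum_cosh[of 1 1], of z]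
  by (simp add: complex_cosh_of_real)

section \<open>The perturbation and its zeros\<close>

text \<open>Each factor is at most \<open>exp (2 * u n) * exp (a n * \<bar>Re z\<bar>)\<close>, so the exponential type of the
product is at most \<open>\<Sum>n. a n\<close>.\<close>

lemma norm_prod_factors_le:
  fixes g :: "nat \<Rightarrow> complex \<Rightarrow> complex"
  assumes bd: "\<And>n. cmod (g n z) \<le> 1 + u n + u n * exp (a n * \<bar>Re z\<bar>)"
    and u: "\<And>n. 0 \<le> u n" "summable u"
    and a: "\<And>n. 0 \<le> a n" "summable a" "suminf a \<le> 1 / 2"
  shows "cmod (\<Prod>n<N. g n z) \<le> exp (2 * suminf u) * exp (\<bar>Re z\<bar> / 2)"
proof -
  have "cmod (g n z) \<le> exp (2 * u n + a n * \<bar>Re z\<bar>)" for n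
  proof -
    have "1 \<le> exp (a n * \<bar>Re z\<bar>)"
      using a by simp
    then have "1 + u n \<le> (1 + u n) * exp (a n * \<bar>Re z\<bar>)"
      using u(1)[of n] by (simp add: mult_le_cancel_left1)
    then have "cmod (g n z) \<le> (1 + 2 * u n) * exp (a n * \<bar>Re z\<bar>)"
      using bd[of n] by (simp add: algebra_simps)
    also have "\<dots> \<le> exp (2 * u n) * exp (a n * \<bar>Re z\<bar>)"
      using exp_ge_add_one_self[of "2 * u n"] by (intro mult_right_mono) auto
    finally show ?thesis by (simp add: exp_add)
  qed
  then have "cmod (\<Prod>n<N. g n z) \<le> (\<Prod>n<N. exp (2 * u n + a n * \<bar>Re z\<bar>))"
    unfolding prod_norm[symmetric] by (intro prod_mono) auto
  also have "\<dots> = exp (2 * (\<Sum>n<N. u n) + (\<Sum>n<N. a n) * \<bar>Re z\<bar>)"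
    by (simp add: exp_sum[symmetric] sum.distrib sum_distrib_left sum_distrib_right)
  also have "\<dots> \<le> exp (2 * suminf u + 1/2 * \<bar>Re z\<bar>)"
  proof -
    have "(\<Sum>n<N. u n) \<le> suminf u"
      using u by (intro sum_le_suminf) auto
    moreover have "(\<Sum>n<N. a n) \<le> 1/2"
      using sum_le_suminf[OF a(2), of "{..<N}"] a by auto
    then have "(\<Sum>n<N. a n) * \<bar>Re z\<bar> \<le> 1/2 * \<bar>Re z\<bar>"
      by (rule mult_right_mono) auto
    ultimately show ?thesis by simp
  qed
  finally show ?thesis by (simp add: exp_add)
qed

text \<open>\<open>B = H + G\<close> with an even product \<open>H\<close> and an odd product \<open>G\<close>, so that
\<open>B x - B (- x) = 2 * G x\<close>. The number \<open>u n\<close> is chosen to make the \<open>n\<close>-th factor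
\<open>1 + u n - u n * cosh (a n * z)\<close> of \<open>G\<close> vanish at \<open>r n\<close>. The factor \<open>sinh (z/2)\<close>
makes \<open>G\<close> odd, and \<open>H\<close> is \<open>G\<close> with all coefficients replaced by their absolute values, which
is why \<open>B\<close> is a limit of exponential sums with nonnegative coefficients. The exponents of the partial
products lie in \<open>{-1..1}\<close>: one half of that range is used up by \<open>cosh (z/2)\<close> and \<open>sinh (z/2)\<close>, the
other by \<open>\<Sum>n. a n\<close>.\<close>

lemma ridge_function_balanced_exactly_at:
  fixes r a :: "nat \<Rightarrow> real"
  defines "u \<equiv> \<lambda>n. 1 / (cosh (a n * r n) - 1)"
  assumes r: "\<And>n. 0 < r n" and a: "\<And>n. 0 < a n" "summable a" "suminf a \<le> 1 / 2"
    and u: "summable u"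
  obtains B P where "B holomorphic_on UNIV"
    "\<And>z. cmod (B z) \<le> Re (B (of_real (Re z)))"
    "convex_on UNIV (\<lambda>x. Re (B (of_real x)))"
    "\<And>z. cmod (B z) \<le> P * exp \<bar>Re z\<bar>"
    "\<And>x. 0 < x \<Longrightarrow> B (of_real x) = B (- of_real x) \<longleftrightarrow> x \<in> range r"
proof -
  have cosh1: "cosh (a n * r n) > 1" for n
    using a(1)[of n] r[of n] cosh_real_nonneg_less_iff[of 0 "a n * r n"] by simp
  then have u0: "0 < u n" for n
    by (simp add: u_def)
  define g where "g n z = 1 + of_real (u n) - of_real (u n) * cosh (of_real (a n) * z)" for n and z :: complex
  define h where "h n z = 1 + of_real (u n) + of_real (u n) * cosh (of_real (a n) * z)" for n and z :: complex
  have a_le: "a n \<le> 1" for n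
    using sum_le_suminf[OF a(2), of "{n}"] a(1,3) by (auto simp: less_imp_le)
  have cosh_bd: "cmod (cosh (of_real (a n) * z)) \<le> exp (a n * \<bar>Re z\<bar>)" for n z
    using norm_cosh_le[of "of_real (a n) * z"] a(1)[of n] by (simp add: abs_mult)
  have cosh_bd': "cmod (cosh (of_real (a n) * z)) \<le> exp R" if "cmod z \<le> R" for n z R
  proof -
    have "a n * \<bar>Re z\<bar> \<le> 1 * R"
      using a_le a(1)[of n] abs_Re_le_cmod[of z] that by (intro mult_mono) auto
    then show ?thesis
      by (intro order_trans[OF cosh_bd]) simp
  qed
  have gR: "cmod (g n z - 1) \<le> u n * (1 + exp R)" if "cmod z \<le> R" for n z R
  proof -
    have "g n z - 1 = of_real (u n) * (1 - cosh (of_real (a n) * z))"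
      by (simp add: g_def algebra_simps)
    moreover have "cmod (1 - cosh (of_real (a n) * z)) \<le> 1 + exp R"
      using norm_triangle_ineq4[of 1 "cosh (of_real (a n) * z)"] cosh_bd'[OF that, of n] by simp
    ultimately show ?thesis
      using u0[of n] by (simp add: norm_mult)
  qed
  have hR: "cmod (h n z - 1) \<le> u n * (1 + exp R)" if "cmod z \<le> R" for n z R
  proof -
    have "h n z - 1 = of_real (u n) * (1 + cosh (of_real (a n) * z))"
      by (simp add: h_def algebra_simps)
    moreover have "cmod (1 + cosh (of_real (a n) * z)) \<le> 1 + exp R"
      using norm_triangle_ineq[of 1 "cosh (of_real (a n) * z)"] cosh_bd'[OF that, of n] by simp
    ultimately show ?thesis
      using u0[of n] by (simp add: norm_mult)
  qed
  have cosh_hol: "(\<lambda>z. cosh (c * z)) holomorphic_on UNIV" "(\<lambda>z. sinh (c * z)) holomorphic_on UNIV" for c :: complex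
    unfolding cosh_field_def sinh_field_def by (auto intro!: holomorphic_intros)
  have "g n holomorphic_on UNIV" for n
    unfolding g_def by (intro holomorphic_intros cosh_hol)
  then obtain Qg where Qg: "Qg holomorphic_on UNIV" "\<And>z. (\<lambda>N. \<Prod>n<N. g n z) \<longlonglongrightarrow> Qg z"
    "\<And>z. Qg z = 0 \<longleftrightarrow> (\<exists>n. g n z = 0)"
    using entire_product[of g u "\<lambda>R. 1 + exp R"] gR u by metis
  have "h n holomorphic_on UNIV" for n
    unfolding h_def by (intro holomorphic_intros cosh_hol)
  then obtain Qh where Qh: "Qh holomorphic_on UNIV" "\<And>z. (\<lambda>N. \<Prod>n<N. h n z) \<longlonglongrightarrow> Qh z"
    using entire_product[of h u "\<lambda>R. 1 + exp R"] hR u by metis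
  define c :: complex where "c = of_real (1/2)"
  define B where "B z = cosh (c * z) * Qh z + sinh (c * z) * Qg z" for z
  define BN where "BN N z = cosh (c * z) * (\<Prod>n<N. h n z) + sinh (c * z) * (\<Prod>n<N. g n z)" for N z
  have BN: "pos_exp_sum (BN N)" for N
  proof -
    have "exp_majorises (h n) (g n)" for n
      using exp_majorises_factor[OF less_imp_le[OF u0], of n "a n"]
      unfolding g_def[abs_def] h_def[abs_def] .
    then show ?thesis
      using exp_majorises_prod[OF exp_majorises_cosh_sinh[of "1/2"], of h g N]
      unfolding exp_majorises_def BN_def[abs_def] c_def by blast
  qed
  have lim: "(\<lambda>N. BN N z) \<longlonglongrightarrow> B z" for z
    unfolding BN_def B_def by (intro tendsto_intros Qg Qh)
  have ridge: "cmod (B z) \<le> Re (B (of_real (Re z)))" for z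
    by (rule pos_exp_sum_limit_ridge(1)[OF BN lim])
  have conv: "convex_on UNIV (\<lambda>x. Re (B (of_real x)))"
    by (rule pos_exp_sum_limit_ridge(2)[OF BN lim])
  have "B holomorphic_on UNIV"
    unfolding B_def by (intro holomorphic_intros cosh_hol Qg Qh)
  moreover have "cmod (B z) \<le> 2 * exp (2 * suminf u) * exp \<bar>Re z\<bar>" for z
  proof -
    let ?E = "exp (2 * suminf u) * exp (\<bar>Re z\<bar> / 2)"
    have "cmod (g n z) \<le> 1 + u n + u n * exp (a n * \<bar>Re z\<bar>)"
         "cmod (h n z) \<le> 1 + u n + u n * exp (a n * \<bar>Re z\<bar>)" for n
    proof -
      have *: "cmod (of_real (u n) * cosh (of_real (a n) * z)) \<le> u n * exp (a n * \<bar>Re z\<bar>)"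
        using cosh_bd[of n z] u0[of n] by (simp add: norm_mult)
      have **: "cmod (1 + of_real (u n)) = 1 + u n"
      proof -
        have "1 + complex_of_real (u n) = of_real (1 + u n)"
          by simp
        then show ?thesis
          using u0[of n] by (simp only: norm_of_real)
      qed
      show "cmod (g n z) \<le> 1 + u n + u n * exp (a n * \<bar>Re z\<bar>)"
        using norm_triangle_ineq4[of "1 + of_real (u n)" "of_real (u n) * cosh (of_real (a n) * z)"] * **
        unfolding g_def by linarith
      show "cmod (h n z) \<le> 1 + u n + u n * exp (a n * \<bar>Re z\<bar>)"
        using norm_triangle_ineq[of "1 + of_real (u n)" "of_real (u n) * cosh (of_real (a n) * z)"] * **
        unfolding h_def by linarith
    qed
    then have "cmod (\<Prod>n<N. g n z) \<le> ?E" "cmod (\<Prod>n<N. h n z) \<le> ?E" for N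
      by (blast intro: norm_prod_factors_le[OF _ less_imp_le[OF u0] u less_imp_le[OF a(1)] a(2,3)])+
    then have Q: "cmod (Qg z) \<le> ?E" "cmod (Qh z) \<le> ?E"
      by (auto intro!: LIMSEQ_le_const2[OF tendsto_norm[OF Qg(2)]] LIMSEQ_le_const2[OF tendsto_norm[OF Qh(2)]])
    have c: "cmod (cosh (c * z)) \<le> exp (\<bar>Re z\<bar> / 2)" "cmod (sinh (c * z)) \<le> exp (\<bar>Re z\<bar> / 2)"
      using norm_cosh_le[of "c * z"] norm_sinh_le[of "c * z"] by (auto simp: c_def)
    have "cmod (B z) \<le> cmod (cosh (c * z)) * cmod (Qh z) + cmod (sinh (c * z)) * cmod (Qg z)"
      unfolding B_def using norm_triangle_ineq norm_mult by metis
    also have "\<dots> \<le> exp (\<bar>Re z\<bar> / 2) * ?E + exp (\<bar>Re z\<bar> / 2) * ?E"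
      by (intro add_mono mult_mono Q c) auto
    also have "\<dots> = 2 * exp (2 * suminf u) * (exp (\<bar>Re z\<bar> / 2) * exp (\<bar>Re z\<bar> / 2))"
      by (simp add: algebra_simps)
    also have "exp (\<bar>Re z\<bar> / 2) * exp (\<bar>Re z\<bar> / 2) = exp \<bar>Re z\<bar>"
      by (simp flip: exp_add)
    finally show ?thesis .
  qed
  moreover have "B (of_real x) = B (- of_real x) \<longleftrightarrow> x \<in> range r" if x: "0 < x" for x
  proof -
    have "g n (- z) = g n z" "h n (- z) = h n z" for n z
      by (auto simp: g_def h_def)
    then have "Qg (- z) = Qg z" "Qh (- z) = Qh z" for z
      using LIMSEQ_unique[OF Qg(2)[of z]] LIMSEQ_unique[OF Qh(2)[of z]] Qg(2)[of "- z"] Qh(2)[of "- z"]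
      by auto
    then have "B (of_real x) - B (- of_real x) = 2 * sinh (c * of_real x) * Qg (of_real x)"
      by (simp add: B_def)
    moreover have "sinh (c * of_real x) \<noteq> 0"
    proof -
      have "sinh (c * of_real x) = of_real (sinh (x / 2))"
      proof -
        have "c * of_real x = of_real (x / 2)"
          by (simp add: c_def)
        then show ?thesis
          by (simp only: complex_sinh_of_real)
      qed
      then show ?thesis using x by simp
    qed
    ultimately have "B (of_real x) = B (- of_real x) \<longleftrightarrow> (\<exists>n. g n (of_real x) = 0)"
      using Qg(3)[of "of_real x"] by auto
    also have "\<dots> \<longleftrightarrow> (\<exists>n. x = r n)"
    proof -
      have "g n (of_real x) = 0 \<longleftrightarrow> x = r n" for n
      proof -
        have "g n (of_real x) = of_real (1 + u n - u n * cosh (a n * x))"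
          unfolding g_def of_real_mult[symmetric] complex_cosh_of_real by simp
        then have "g n (of_real x) = 0 \<longleftrightarrow> 1 + u n - u n * cosh (a n * x) = 0"
          by (simp only: of_real_eq_0_iff)
        also have "\<dots> \<longleftrightarrow> cosh (a n * x) = cosh (a n * r n)"
        proof -
          have "1 + u n - u n * cosh (a n * x) = u n * (cosh (a n * r n) - cosh (a n * x))"
            using a(1)[of n] r[of n] by (simp add: u_def divide_simps)
          then show ?thesis
            using u0[of n] by auto
        qed
        also have "\<dots> \<longleftrightarrow> a n * x = a n * r n"
          using a(1)[of n] r[of n] x by (simp add: abs_mult)
        finally show ?thesis using a(1)[of n] by simp
      qed
      then show ?thesis by simp
    qed
    finally show ?thesis by auto
  qed
  ultimately show ?thesis
    using that ridge conv by blast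
qed

section \<open>Membership in the Eremenko--Lyubich class and order\<close>

text \<open>Where \<open>\<bar>f z\<bar>\<close> is large, \<open>\<bar>Re z\<bar>\<close> is greater than 1, so that \<open>A * sinh z\<close> has modulus at least
\<open>P * (8 * exp \<bar>Re z\<bar> - 8)\<close>, whereas Cauchy's estimate on the unit circle about \<open>z\<close>
bounds \<open>B'\<close> by \<open>3 * P * exp \<bar>Re z\<bar>\<close>. The constant 16 leaves enough room for the difference to
exceed 1. A polynomial is excluded because \<open>f\<close> is bounded on the imaginary axis and unbounded on the
real axis.\<close>

lemma cosh_plus_small_ridge_class_B:
  fixes A P :: real
  assumes B: "B holomorphic_on UNIV"
    and ridge: "\<And>z. cmod (B z) \<le> Re (B (of_real (Re z)))"
    and P: "\<And>z. cmod (B z) \<le> P * exp \<bar>Re z\<bar>"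
    and "1 \<le> P" "A = 16 * P"
  defines "f \<equiv> \<lambda>z. of_real A * cosh z + B z"
  shows "f \<in> eremenko_lyubich_class" "growth_order f < \<infinity>"
proof -
  have coshhol: "cosh holomorphic_on (UNIV :: complex set)"
    unfolding cosh_field_def[abs_def] by (auto intro!: holomorphic_intros)
  have hol: "f holomorphic_on UNIV"
    unfolding f_def by (intro holomorphic_intros coshhol B)
  have A: "A \<ge> 16" "P > 0" using assms by auto
  have fle: "cmod (f z) \<le> (A + P) * exp \<bar>Re z\<bar>" for z
  proof -
    have "cmod (of_real A * cosh z) \<le> A * exp \<bar>Re z\<bar>"
      using mult_left_mono[OF norm_cosh_le[of z], of A] A by (simp add: norm_mult)
    then show ?thesis
      using norm_triangle_ineq[of "of_real A * cosh z" "B z"] P[of z]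
      unfolding f_def distrib_right by linarith
  qed
  have fge: "A * cosh x \<le> cmod (f (of_real x))" for x
  proof -
    have "Re (f (of_real x)) = A * cosh x + Re (B (of_real x))"
      by (simp add: f_def complex_cosh_of_real)
    moreover have "0 \<le> Re (B (of_real x))"
      using order_trans[OF norm_ge_zero ridge[of "of_real x"]] by simp
    ultimately show ?thesis
      using complex_Re_le_cmod[of "f (of_real x)"] by linarith
  qed
  have dB: "cmod (deriv B z) \<le> P * exp (\<bar>Re z\<bar> + 1)" for z
  proof -
    have "cmod ((deriv ^^ 1) B z) \<le> fact 1 * (P * exp (\<bar>Re z\<bar> + 1)) / 1 ^ 1"
    proof (rule Cauchy_inequality)
      show "cmod (B x) \<le> P * exp (\<bar>Re z\<bar> + 1)" if "cmod (z - x) = 1" for x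
      proof -
        have "\<bar>Re x\<bar> \<le> \<bar>Re z\<bar> + 1"
          using abs_Re_le_cmod[of "z - x"] that by simp
        then show ?thesis
          using P[of x] A by (smt (verit) exp_le_cancel_iff mult_left_mono)
      qed
    qed (use B in \<open>auto intro: holomorphic_on_subset holomorphic_on_imp_continuous_on\<close>)
    then show ?thesis by simp
  qed
  have df: "deriv f z = of_real A * sinh z + deriv B z" for z
    unfolding f_def
    by (rule DERIV_imp_deriv) (auto intro!: derivative_eq_intros holomorphic_derivI[OF B])
  have "bounded (singular_values f)"
  proof (rule bounded_singular_values_if_deriv_bounded_below[OF hol, of 1 "(A + P) * exp 1"])
    fix z assume "(A + P) * exp 1 < cmod (f z)"
    then have "(A + P) * exp 1 < (A + P) * exp \<bar>Re z\<bar>"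
      using fle[of z] by linarith
    then have x: "1 < \<bar>Re z\<bar>"
      using A by simp
    have e: "exp 1 < (3::real)" "2 \<le> exp \<bar>Re z\<bar>"
      using e_less_272 exp_ge_add_one_self[of "\<bar>Re z\<bar>"] x by linarith+
    have "A * ((exp \<bar>Re z\<bar> - 1) / 2) \<le> cmod (of_real A * sinh z)"
      using norm_sinh_ge[of z] A by (simp add: norm_mult)
    moreover have "A * ((exp \<bar>Re z\<bar> - 1) / 2) = P * (8 * exp \<bar>Re z\<bar> - 8)"
      using assms by (simp add: field_simps)
    moreover have "cmod (deriv B z) \<le> P * (3 * exp \<bar>Re z\<bar>)"
    proof -
      have "exp (\<bar>Re z\<bar> + 1) \<le> 3 * exp \<bar>Re z\<bar>"
        using e by (simp add: exp_add)
      then show ?thesis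
        using dB[of z] A by (smt (verit) mult_left_mono)
    qed
    moreover have "cmod (of_real A * sinh z) - cmod (deriv B z) \<le> cmod (deriv f z)"
      unfolding df by (simp add: norm_diff_ineq)
    moreover have "1 * 2 \<le> P * (5 * exp \<bar>Re z\<bar> - 8)"
      using e \<open>1 \<le> P\<close> by (intro mult_mono) auto
    ultimately show "1 \<le> cmod (deriv f z)"
      by (simp add: right_diff_distrib)
  qed simp
  moreover have "\<not> (\<exists>p. \<forall>z. f z = poly p z)"
  proof
    assume "\<exists>p. \<forall>z. f z = poly p z"
    then obtain p where p: "\<And>z. f z = poly p z" by blast
    have "degree p = 0"
    proof (rule ccontr)
      assume "degree p \<noteq> 0"
      then have "filterlim (poly p) at_infinity at_infinity"
        by (intro filterlim_poly_at_infinity) auto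
      moreover have "filterlim (\<lambda>y::real. \<i> * of_real y) at_infinity at_top"
        unfolding filterlim_at_infinity[OF order_refl]
      proof (intro allI impI)
        show "\<forall>\<^sub>F y in at_top. s \<le> cmod (\<i> * of_real y)" for s :: real
          using eventually_ge_at_top[of s] by eventually_elim (simp add: norm_mult)
      qed
      ultimately have "filterlim (\<lambda>y::real. f (\<i> * of_real y)) at_infinity at_top"
        unfolding p by (rule filterlim_compose)
      then have "\<forall>\<^sub>F y in at_top. A + P + 1 \<le> cmod (f (\<i> * of_real y))"
        unfolding filterlim_at_infinity[OF order_refl] using A by auto
      then obtain y where "A + P + 1 \<le> cmod (f (\<i> * of_real y))"
        using eventually_happens'[OF trivial_limit_at_top_linorder] by blast
      then show False
        using fle[of "\<i> * of_real y"] by simp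
    qed
    then obtain k where "p = [:k:]"
      using degree_eq_zeroE by blast
    then have const: "f z = f 0" for z
      by (simp add: p)
    have "A * cosh (A + P) \<le> A + P"
      using fge[of "A + P"] fle[of 0] const[of "of_real (A + P)"] by simp
    moreover have "A + P < 2 * cosh (A + P)"
    proof -
      have "2 * cosh (A + P) = exp (A + P) + exp (- (A + P))"
        by (simp add: cosh_field_def)
      then show ?thesis
        using exp_ge_add_one_self[of "A + P"] exp_gt_zero[of "- (A + P)"] by linarith
    qed
    moreover have "2 * cosh (A + P) \<le> A * cosh (A + P)"
      using A by (intro mult_right_mono) auto
    ultimately show False by linarith
  qed
  ultimately show "f \<in> eremenko_lyubich_class"
    using hol by (simp add: eremenko_lyubich_class_def transcendental_entire_def)
  \<comment> \<open>The exponential type gives order at most 1; the cruder bound \<open>ln (max_modulus s f) \<le> s^2\<close> for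
    large \<open>s\<close> is enough for finite order.\<close>
  have "growth_order f \<le> ereal 2"
    unfolding growth_order_def
  proof (rule Limsup_bounded)
    show "\<forall>\<^sub>F s in at_top. ereal (ln (ln (max_modulus s f)) / ln s) \<le> ereal 2"
      using eventually_ge_at_top[of "max 2 (ln (A + P))"]
    proof eventually_elim
      case (elim s)
      have s: "2 \<le> s" "ln (A + P) \<le> s" using elim by auto
      obtain z where z: "z \<in> sphere 0 s" "cmod (f z) = max_modulus s f"
        "\<And>w. w \<in> sphere 0 s \<Longrightarrow> cmod (f w) \<le> cmod (f z)"
        using max_modulus_attained[OF hol, of s] s by auto
      have "exp 1 \<le> A * cosh s"
        using A cosh_real_ge_1[of s] e_less_272 mult_mono[of 16 A 1 "cosh s"] by linarith
      then have lo: "exp 1 \<le> max_modulus s f"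
        using fge[of s] z(2) z(3)[of "of_real s"] s by simp
      then have pos: "0 < max_modulus s f"
        using exp_gt_zero[of 1] by linarith
      then have "1 \<le> ln (max_modulus s f)"
        using lo by (simp add: ln_ge_iff)
      have "max_modulus s f \<le> (A + P) * exp s"
      proof -
        have "exp \<bar>Re z\<bar> \<le> exp s"
          using abs_Re_le_cmod[of z] z(1) by simp
        then show ?thesis
          using fle[of z] z(2) A by (smt (verit) mult_left_mono)
      qed
      then have "ln (max_modulus s f) \<le> ln ((A + P) * exp s)"
        using pos A by simp
      also have "\<dots> = ln (A + P) + s"
        using A by (simp add: ln_mult)
      also have "\<dots> \<le> s ^ 2"
        using s mult_right_mono[of 2 s s] unfolding power2_eq_square by linarith
      finally have "ln (ln (max_modulus s f)) \<le> ln (s ^ 2)"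
        using \<open>1 \<le> ln (max_modulus s f)\<close> s by simp
      also have "\<dots> = 2 * ln s"
        using s by (simp add: ln_realpow)
      finally show ?case
        using s by (simp add: field_simps)
    qed
  qed
  then show "growth_order f < \<infinity>"
    by (rule order_le_less_trans) simp
qed

section \<open>The construction for a sequence of geometric growth\<close>

theorem theorem1p3:
  fixes r :: "nat \<Rightarrow> real"
  assumes "\<And>n. 0 < r n"
    and "\<exists>C>1. \<forall>n. r (Suc n) > C * r n"
  shows "\<exists>f. f \<in> eremenko_lyubich_class \<and> growth_order f < \<infinity> \<and>
           (\<forall>n. has_discontinuity_at f (r n))"
proof -
  obtain C where C: "C > 1" "\<And>n. r (Suc n) > C * r n"
    using assms(2) by blast
  have inc: "r n < r (Suc n)" for n
  proof -
    have "1 * r n \<le> C * r n"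
      using C(1) assms(1)[of n] by (intro mult_right_mono) auto
    then show ?thesis using C(2)[of n] by linarith
  qed
  then have mono: "strict_mono r"
    by (rule strict_mono_Suc_iff[THEN iffD2, rule_format])
  have growth: "r 0 * C ^ n \<le> r n" for n
  proof (induction n)
    case (Suc n)
    have "r 0 * C ^ Suc n \<le> C * r n"
      using mult_left_mono[OF Suc, of C] C(1) by (simp add: mult_ac)
    then show ?case using C(2)[of n] by linarith
  qed simp
  \<comment> \<open>Both \<open>a n\<close> and \<open>1 / (a n * r n)^2\<close> have to be summable. The geometric mean of the constant sequence and \<open>1 / C^n\<close> achieves both.\<close>
  define q where "q = 1 / sqrt C"
  have q: "0 < q" "q < 1" "q ^ 2 * C = 1"
    using C(1) by (auto simp: q_def power_divide)
  define a where "a n = (1 - q) / 2 * q ^ n" for n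
  have a_pos: "0 < a n" for n
    using q by (simp add: a_def)
  have "a sums ((1 - q) / 2 * (1 / (1 - q)))"
    unfolding a_def using q by (intro sums_mult geometric_sums) auto
  then have a_sum: "summable a" "suminf a \<le> 1 / 2"
    using q by (auto simp: sums_iff)
  define \<kappa> where "\<kappa> = (1 - q) / 2 * r 0"
  have "\<kappa> > 0"
    using q assms(1) by (simp add: \<kappa>_def)
  have u_sum: "summable (\<lambda>n. 1 / (cosh (a n * r n) - 1))"
  proof (rule summable_comparison_test')
    have "0 < 1 / C" "1 / C < 1" using C(1) by auto
    then show "summable (\<lambda>n. 8 / \<kappa> ^ 2 * (1 / C) ^ n)"
      by (intro summable_mult summable_geometric) auto
    fix n :: nat
    have "\<kappa> * (q * C) ^ n \<le> a n * r n"
      using mult_left_mono[OF growth[of n], of "a n"] a_pos[of n]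
      by (simp add: a_def \<kappa>_def power_mult_distrib mult_ac)
    then have "(\<kappa> * (q * C) ^ n) ^ 2 \<le> (a n * r n) ^ 2"
      using \<open>\<kappa> > 0\<close> q C(1) by (intro power_mono) auto
    moreover have "(\<kappa> * (q * C) ^ n) ^ 2 = \<kappa> ^ 2 * C ^ n"
    proof -
      have "(q * C) ^ 2 = C"
        using q(3) by (simp add: power2_eq_square mult_ac)
      then show ?thesis
        by (metis power_commutes power_mult power_mult_distrib mult.commute)
    qed
    moreover have "(a n * r n) ^ 2 / 8 \<le> cosh (a n * r n) - 1"
      using a_pos[of n] assms(1)[of n] by (intro cosh_real_ge_quadratic) auto
    ultimately have *: "\<kappa> ^ 2 * C ^ n / 8 \<le> cosh (a n * r n) - 1"
      by linarith
    moreover have **: "0 < \<kappa> ^ 2 * C ^ n / 8"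
      using \<open>\<kappa> > 0\<close> C(1) by auto
    ultimately have "1 / (cosh (a n * r n) - 1) \<le> 1 / (\<kappa> ^ 2 * C ^ n / 8)"
      by (intro divide_left_mono) (auto intro: mult_pos_pos)
    then show "norm (1 / (cosh (a n * r n) - 1)) \<le> 8 / \<kappa> ^ 2 * (1 / C) ^ n"
      using * ** by (simp add: power_divide)
  qed
  obtain B P0 where B: "B holomorphic_on UNIV"
    "\<And>z. cmod (B z) \<le> Re (B (of_real (Re z)))"
    "convex_on UNIV (\<lambda>x. Re (B (of_real x)))"
    "\<And>z. cmod (B z) \<le> P0 * exp \<bar>Re z\<bar>"
    "\<And>x. 0 < x \<Longrightarrow> B (of_real x) = B (- of_real x) \<longleftrightarrow> x \<in> range r"
    using ridge_function_balanced_exactly_at[OF assms(1) a_pos a_sum u_sum] by metis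
  define P where "P = max 1 P0"
  have P: "1 \<le> P" "cmod (B z) \<le> P * exp \<bar>Re z\<bar>" for z
    using order_trans[OF B(4)[of z] mult_right_mono[of P0 P "exp \<bar>Re z\<bar>"]] by (auto simp: P_def)
  define A where "A = 16 * P"
  define f where "f z = of_real A * cosh z + B z" for z
  define \<phi> where "\<phi> x = A * cosh x + Re (B (of_real x))" for x
  have "A > 0" using P(1) by (simp add: A_def)
  have B_real: "B (of_real x) = of_real (Re (B (of_real x)))" for x
  proof -
    have "Im (B (of_real x)) = 0"
      using B(2)[of "of_real x"] cmod_power2[of "B (of_real x)"] abs_Re_le_cmod[of "B (of_real x)"]
      by (smt (verit) Re_complex_of_real power2_eq_iff_nonneg zero_eq_power2 norm_ge_zero)
    then show ?thesis by (simp add: complex_eq_iff)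
  qed
  have dom: "cmod (f z) \<le> \<phi> (Re z)" for z
  proof -
    have "cmod (of_real A * cosh z) \<le> A * cosh (Re z)"
      using mult_left_mono[OF norm_cosh_le_cosh_Re[of z], of A] \<open>A > 0\<close> by (simp add: norm_mult)
    then show ?thesis
      using norm_triangle_ineq[of "of_real A * cosh z" "B z"] B(2)[of z]
      unfolding f_def \<phi>_def by linarith
  qed
  have real: "f (of_real x) = of_real (\<phi> x)" for x
    using B_real[of x] by (simp add: f_def \<phi>_def complex_cosh_of_real)
  \<comment> \<open>On the real line, the convex function \<open>B\<close> is at most its chord over \<open>{- s..s}\<close>, and the even function \<open>cosh\<close>
    is strictly less than its constant chord.\<close>
  have strict: "\<phi> x < max (\<phi> s) (\<phi> (- s))" if xs: "\<bar>x\<bar> < s" for x s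
  proof -
    define t where "t = (s + x) / (2 * s)"
    have t: "0 \<le> t" "t \<le> 1" "(1 - t) * (- s) + t * s = x"
      using xs by (auto simp: t_def field_simps)
    have "Re (B (of_real x)) \<le> (1 - t) * Re (B (of_real (- s))) + t * Re (B (of_real s))"
      using convex_onD[OF B(3) t(1,2) UNIV_I UNIV_I, of "- s" s] unfolding real_scaleR_def t(3) .
    moreover have "A * cosh x < A * cosh s"
      using cosh_real_nonneg_less_iff[of "\<bar>x\<bar>" s] xs \<open>A > 0\<close> by simp
    ultimately have "\<phi> x < (1 - t) * \<phi> (- s) + t * \<phi> s"
      by (simp add: \<phi>_def algebra_simps)
    also have "\<dots> \<le> (1 - t) * max (\<phi> s) (\<phi> (- s)) + t * max (\<phi> s) (\<phi> (- s))"
      using t by (intro add_mono mult_left_mono) auto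
    finally show ?thesis by (simp add: algebra_simps)
  qed
  have balanced: "\<phi> x = \<phi> (- x) \<longleftrightarrow> x \<in> range r" if "0 < x" for x
    using B(5)[OF that] B_real[of x] B_real[of "- x"] by (auto simp: \<phi>_def)
  have "has_discontinuity_at f (r n)" for n
  proof (rule has_discontinuity_at_if_swap[OF dom real strict assms(1)])
    show "\<phi> (r n) = \<phi> (- r n)"
      using balanced[OF assms(1)] by auto
    show "\<exists>x. t < x \<and> x < r n \<and> \<phi> x \<noteq> \<phi> (- x)" if t: "t < r n" for t
    proof -
      \<comment> \<open>No member of the sequence lies strictly between \<open>l\<close> and \<open>r n\<close>.\<close>
      define l where "l = Max ({0, t} \<union> r ` {..<n})"
      have "l < r n"
        unfolding l_def using t assms(1) mono by (auto simp: strict_mono_less)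
      then obtain x where x: "l < x" "x < r n"
        using dense by blast
      have l: "y \<le> l" if "y \<in> {0, t} \<union> r ` {..<n}" for y
        unfolding l_def using that by (intro Max_ge) auto
      have "x \<notin> range r"
      proof
        assume "x \<in> range r"
        then obtain m where m: "x = r m" by blast
        then have "m < n"
          using x mono by (simp add: strict_mono_less)
        then show False
          using l[of "r m"] m x by auto
      qed
      then show ?thesis
        using x l[of 0] l[of t] balanced[of x] by (intro exI[of _ x]) auto
    qed
  qed
  moreover have "f \<in> eremenko_lyubich_class" "growth_order f < \<infinity>"
    using cosh_plus_small_ridge_class_B[OF B(1,2) P(2,1) A_def] by (simp_all add: f_def[abs_def])
  ultimately show ?thesis
    by blast
qed

end
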